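(* Let $n \ge K \ge 1$ be integers. Consider parameter tuples $(\alpha_n, \Theta, Z, B)$, where $\alpha_n>0$ is a scalar, $\Theta=\mathrm{diag}(\theta_1,\dots,\theta_n)$ is an $n\times n$ diagonal matrix, $Z$ is an $n\times K$ real matrix and $B$ is a $K\times K$ real symmetric matrix, satisfying the following conditions: (I1) $B$ is full rank and strictly positive definite, with $B_{kk}=1$ for all $k=1,\dots,K$; (I2) $Z_{ik}\ge 0$ for all $i,k$; $\|Z_{i\cdot}\|_2=1$ for all $i=1,\dots,n$; and for each $k=1,\dots,K$ there exists at least one $i$ such that $Z_{ik}=1$; (I3) $\theta_1,\dots,\theta_n$ are all positive and $n^{-1}\sum_{i=1}^n\theta_i=1$. Then the model $W=\alpha_n\,\Theta Z B Z^T\Theta$ is identifiable up to a permutation of community labels. That is, if $(\alpha_{n,1},\Theta_1,Z_1,B_1)$ and $(\alpha_{n,2},\Theta_2,Z_2,B_2)$ both satisfy (I1), (I2), (I3) and yield the same probability matrix, $$\alpha_{n,1}\Theta_1Z_1B_1Z_1^T\Theta_1=W=\alpha_{n,2}\Theta_2Z_2B_2Z_2^T\Theta_2,$$ then $\alpha_{n,1}=\alpha_{n,2}$, $\Theta_1=\Theta_2$, and there is a $K\times K$ permutation matrix $P$ such that $Z_2=Z_1P$ and $B_2=P^TB_1P$.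
   Context: $Z_{i\cdot}$ denotes the $i$-th row of $Z$. The matrix $W$ is the $n\times n$ matrix of edge probabilities (entries in $[0,1]$) of a random network on $n$ nodes with $K$ communities: $\alpha_n$ is a global scaling factor, $\theta_i$ are degree parameters, $Z$ is the community membership matrix, and $B$ is the matrix of scaled connection probabilities between communities. A permutation of community labels acts by simultaneously permuting the columns of $Z$ and the rows and columns of $B$. *)

theory Defs
  imports "HOL-Analysis.Analysis"
begin

text \<open>Nodes are indexed by the finite type \<open>'n\<close> and communities by the finite type \<open>'k\<close>,
  so that \<open>n = CARD('n)\<close> and \<open>K = CARD('k)\<close>.\<close>

definition diag :: "real^'n \<Rightarrow> real^'n^'n" where
  "diag d = (\<chi> i j. if i = j then d $ i else 0)"

definition symmetric_matrix :: "real^'k^'k \<Rightarrow> bool" where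
  "symmetric_matrix B \<longleftrightarrow> transpose B = B"

text \<open>Symmetry is not part of this definition; it is required separately.\<close>

definition strictly_pos_def :: "real^'k^'k \<Rightarrow> bool" where
  "strictly_pos_def B \<longleftrightarrow> (\<forall>x. x \<noteq> 0 \<longrightarrow> x \<bullet> (B *v x) > 0)"

definition permutation_matrix :: "real^'k^'k \<Rightarrow> bool" where
  "permutation_matrix P \<longleftrightarrow>
     (\<forall>i j. P $ i $ j = 0 \<or> P $ i $ j = 1) \<and>
     (\<forall>i. \<exists>!j. P $ i $ j = 1) \<and>
     (\<forall>j. \<exists>!i. P $ i $ j = 1)"

definition cond_I1 :: "real^'k^'k \<Rightarrow> bool" where
  "cond_I1 B \<longleftrightarrow> rank B = CARD('k) \<and> strictly_pos_def B \<and> (\<forall>k. B $ k $ k = 1)"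

definition cond_I2 :: "real^'k^'n \<Rightarrow> bool" where
  "cond_I2 Z \<longleftrightarrow>
     (\<forall>i k. Z $ i $ k \<ge> 0) \<and>
     (\<forall>i. norm (row i Z) = 1) \<and>
     (\<forall>k. \<exists>i. Z $ i $ k = 1)"

definition cond_I3 :: "real^'n \<Rightarrow> bool" where
  "cond_I3 \<theta> \<longleftrightarrow>
     (\<forall>i. \<theta> $ i > 0) \<and> (\<Sum>i\<in>UNIV. \<theta> $ i) / real CARD('n) = 1"

definition admissible :: "real \<Rightarrow> real^'n \<Rightarrow> real^'k^'n \<Rightarrow> real^'k^'k \<Rightarrow> bool" where
  "admissible \<alpha> \<theta> Z B \<longleftrightarrow>
     \<alpha> > 0 \<and> symmetric_matrix B \<and> cond_I1 B \<and> cond_I2 Z \<and> cond_I3 \<theta>"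

definition model_matrix :: "real \<Rightarrow> real^'n^'n \<Rightarrow> real^'k^'n \<Rightarrow> real^'k^'k \<Rightarrow> real^'n^'n" where
  "model_matrix \<alpha> \<Theta> Z B = \<alpha> *\<^sub>R (\<Theta> ** Z ** B ** transpose Z ** \<Theta>)"

definition probability_matrix :: "real^'n^'n \<Rightarrow> bool" where
  "probability_matrix W \<longleftrightarrow> (\<forall>i j. 0 \<le> W $ i $ j \<and> W $ i $ j \<le> 1)"

end

theory Submission
  imports Defs
begin

text \<open>Put \<open>Y = \<Theta> Z\<close> and \<open>G = \<alpha> B\<close>, so that \<open>W = Y G Y\<^sup>T\<close>. The pure nodes
  give a nonnegative left inverse \<open>L\<close> of \<open>Y\<close>, and since \<open>G\<close> is invertible, two factorizations
  of \<open>W\<close> satisfy \<open>Y\<^sub>1 = Y\<^sub>2 N\<close> and \<open>Y\<^sub>2 = Y\<^sub>1 N'\<close>, where \<open>N = L\<^sub>2 Y\<^sub>1\<close> and \<open>N' = L\<^sub>1 Y\<^sub>2\<close> are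
  mutually inverse and nonnegative. Such a matrix \<open>N\<close> is monomial. The diagonals of
  \<open>G\<^sub>2 = N G\<^sub>1 N\<^sup>T\<close> show that all its nonzero entries equal \<open>c = sqrt (\<alpha>\<^sub>2 / \<alpha>\<^sub>1)\<close>, so \<open>N\<close> is \<open>c\<close>
  times a permutation matrix. Comparing row norms in \<open>Y\<^sub>1 = Y\<^sub>2 N\<close> yields \<open>\<theta>\<^sub>1 = c \<theta>\<^sub>2\<close>, and the
  normalization of \<open>\<theta>\<close> forces \<open>c = 1\<close>.\<close>

text \<open>Serves products with a sparse factor: diagonal, monomial, or selecting one pure node per
  community.\<close>

lemma matrix_mult_row_single:
  fixes A :: "'a::semiring_1^'m^'n" and B :: "'a^'k^'m"
  assumes "\<And>m. m \<noteq> l \<Longrightarrow> A $ i $ m = 0"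
  shows "(A ** B) $ i $ j = A $ i $ l * B $ l $ j"
  using assms by (simp add: matrix_matrix_mult_def sum.remove[of UNIV l])

lemma matrix_mult_col_single:
  fixes A :: "'a::semiring_1^'m^'n" and B :: "'a^'k^'m"
  assumes "\<And>m. m \<noteq> l \<Longrightarrow> B $ m $ j = 0"
  shows "(A ** B) $ i $ j = A $ i $ l * B $ l $ j"
  using assms by (simp add: matrix_matrix_mult_def sum.remove[of UNIV l])

text \<open>Multiplying \<open>eq\<close> on the right by \<open>transpose L ** G'\<close> cancels
  \<open>G ** transpose A\<close> and leaves \<open>A = B ** N\<close> for some \<open>N\<close>;
  applying \<open>M\<close> identifies \<open>N\<close>.\<close>

lemma factor_through_congruent:
  fixes A B :: "real^'k^'n" and G H :: "real^'k^'k"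
  assumes eq: "A ** G ** transpose A = B ** H ** transpose B"
    and L: "L ** A = mat 1" and M: "M ** B = mat 1" and G: "invertible G"
  shows "A = B ** (M ** A)"
proof -
  have L': "transpose A ** transpose L = mat 1"
    using L by (metis matrix_transpose_mul transpose_mat)
  obtain G' where G': "G ** G' = mat 1"
    using G unfolding invertible_def by blast
  have "A = A ** G ** transpose A ** transpose L ** G'"
    by (simp add: L' G' flip: matrix_mul_assoc)
  also have "\<dots> = B ** (H ** transpose B ** transpose L ** G')"
    by (simp add: eq matrix_mul_assoc)
  finally obtain N where N: "A = B ** N" by blast
  then have "M ** A = N"
    using M by (simp add: matrix_mul_assoc)
  with N show ?thesis by simp
qed

text \<open>The diagonal of \<open>A ** B\<close> supplies \<open>l\<close> with
  \<open>A $ k $ l * B $ l $ k\<close> nonzero. For \<open>m\<close> other than \<open>l\<close>,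
  entry \<open>(l, m)\<close> of \<open>B ** A\<close> is a vanishing sum of nonnegative terms, so
  its term \<open>B $ l $ k * A $ k $ m\<close> is zero, which forces
  \<open>A $ k $ m = 0\<close>.\<close>

lemma nonneg_inverse_row:
  fixes A B :: "real^'k^'k"
  assumes AB: "A ** B = mat 1"
    and A: "\<And>i j. A $ i $ j \<ge> 0" and B: "\<And>i j. B $ i $ j \<ge> 0"
  shows "\<exists>!l. A $ k $ l \<noteq> 0"
proof -
  have BA: "B ** A = mat 1"
    using AB matrix_left_right_inverse by blast
  have "(\<Sum>l\<in>UNIV. A $ k $ l * B $ l $ k) = 1"
    using arg_cong[OF AB, of "\<lambda>M. M $ k $ k"] by (simp add: matrix_matrix_mult_def mat_def)
  then obtain l where l: "A $ k $ l * B $ l $ k \<noteq> 0"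
    using sum.not_neutral_contains_not_neutral[of "\<lambda>l. A $ k $ l * B $ l $ k" UNIV] by auto
  have "A $ k $ m = 0" if "m \<noteq> l" for m
  proof -
    have "(\<Sum>j\<in>UNIV. B $ l $ j * A $ j $ m) = 0"
      using arg_cong[OF BA, of "\<lambda>M. M $ l $ m"] that
      by (simp add: matrix_matrix_mult_def mat_def)
    then have "B $ l $ k * A $ k $ m = 0"
      by (subst (asm) sum_nonneg_eq_0_iff) (auto simp: A B)
    with l show ?thesis by simp
  qed
  with l show ?thesis by (metis mult_zero_left)
qed

lemma nonneg_inverse_col:
  fixes A B :: "real^'k^'k"
  assumes AB: "A ** B = mat 1"
    and A: "\<And>i j. A $ i $ j \<ge> 0" and B: "\<And>i j. B $ i $ j \<ge> 0"
  shows "\<exists>!k. A $ k $ l \<noteq> 0"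
proof -
  have "transpose A ** transpose B = mat 1"
    using AB matrix_left_right_inverse by (metis matrix_transpose_mul transpose_mat)
  from nonneg_inverse_row[OF this, of l] A B show ?thesis
    by (simp add: transpose_def)
qed

lemma permutation_matrix_transpose:
  "permutation_matrix P \<Longrightarrow> permutation_matrix (transpose P)"
  by (auto simp: permutation_matrix_def transpose_def)

lemma permutation_matrix_mult_transpose:
  assumes P: "permutation_matrix P"
  shows "P ** transpose P = mat 1"
proof -
  have "(P ** transpose P) $ i $ j = mat 1 $ i $ j" for i j
  proof -
    obtain l where l: "P $ i $ l = 1" and l': "\<And>m. m \<noteq> l \<Longrightarrow> P $ i $ m = 0"
      using P unfolding permutation_matrix_def by metis
    have "(P ** transpose P) $ i $ j = P $ j $ l"
      by (simp add: matrix_mult_row_single[OF l'] l transpose_def)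
    \<comment> \<open>Column \<open>l\<close> has its only 1 in row \<open>i\<close>.\<close>
    also have "\<dots> = mat 1 $ i $ j"
      using P l unfolding permutation_matrix_def mat_def by (auto; metis)
    finally show ?thesis .
  qed
  then show ?thesis by (simp add: vec_eq_iff)
qed

lemma strictly_pos_def_invertible:
  fixes B :: "real^'k^'k"
  assumes "strictly_pos_def B"
  shows "invertible B"
  using assms unfolding strictly_pos_def_def invertible_left_inverse matrix_left_invertible_ker
  by (metis inner_zero_right less_irrefl)

lemma diag_mult_nth: "(diag d ** Z) $ i $ k = d $ i * Z $ i $ k"
  by (subst matrix_mult_row_single[of i]) (auto simp: diag_def)

text \<open>Absorbing the degrees into \<open>Z\<close> and the scale into \<open>B\<close> gives
  the shape that \<open>factor_through_congruent\<close> expects.\<close>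

lemma model_matrix_factored:
  "model_matrix \<alpha> (diag d) Z B =
     (diag d ** Z) ** (\<alpha> *\<^sub>R B) ** transpose (diag d ** Z)"
proof -
  have "transpose (diag d) = diag d"
    by (auto simp: transpose_def diag_def vec_eq_iff)
  then show ?thesis
    by (simp add: model_matrix_def matrix_transpose_mul matrix_mul_assoc
        matrix_scalar_ac flip: scalar_matrix_assoc)
qed

text \<open>Recovers the degrees from a Gram matrix, which does not change when the communities are
  permuted.\<close>

lemma gram_diag_mult:
  assumes "norm (row i Z) = 1"
  shows "((diag d ** Z) ** transpose (diag d ** Z)) $ i $ i = (d $ i)\<^sup>2"
proof -
  have "row i (diag d ** Z) = d $ i *\<^sub>R row i Z"
    by (simp add: vec_eq_iff row_def diag_mult_nth)
  then have "((diag d ** Z) ** transpose (diag d ** Z)) $ i $ i = (norm (d $ i *\<^sub>R row i Z))\<^sup>2"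
    unfolding matrix_matrix_mult_def transpose_def power2_norm_eq_inner inner_vec_def
    by (simp add: row_def vec_eq_iff)
  then show ?thesis using assms by simp
qed

text \<open>The entry 1 exhausts the unit norm of the row, so the remaining squares sum to
  zero.\<close>

lemma pure_row:
  assumes Z: "cond_I2 Z" and pure: "Z $ i $ k = 1"
  shows "Z $ i $ l = (if l = k then 1 else 0)"
proof -
  have "(norm (row i Z))\<^sup>2 = 1"
    using Z by (simp add: cond_I2_def)
  then have "(\<Sum>m\<in>UNIV. (Z $ i $ m)\<^sup>2) = 1"
    unfolding power2_norm_eq_inner by (simp add: inner_vec_def row_def power2_eq_square)
  then have "(\<Sum>m\<in>UNIV - {k}. (Z $ i $ m)\<^sup>2) = 0"
    using pure by (simp add: sum.remove[of UNIV k])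
  then have "\<forall>m\<in>UNIV - {k}. (Z $ i $ m)\<^sup>2 = 0"
    by (subst (asm) sum_nonneg_eq_0_iff) auto
  with pure show ?thesis by auto
qed

lemma nonneg_left_inverse:
  fixes Z :: "real^'k^'n"
  assumes Z: "cond_I2 Z" and d: "\<And>i. d $ i > 0"
  obtains L :: "real^'n^'k"
  where "L ** (diag d ** Z) = mat 1" "\<And>k i. L $ k $ i \<ge> 0"
proof -
  obtain s where s: "\<And>k. Z $ s k $ k = 1"
    using Z unfolding cond_I2_def by metis
  \<comment> \<open>Row \<open>s k\<close> of \<open>diag d ** Z\<close> is \<open>d $ s k\<close>
    times the \<open>k\<close>-th unit vector; \<open>L\<close> selects this row and rescales
    it.\<close>
  define L :: "real^'n^'k" where "L = (\<chi> k i. if i = s k then 1 / d $ i else 0)"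
  have "(L ** (diag d ** Z)) $ k $ l = mat 1 $ k $ l" for k l
  proof -
    have "(L ** (diag d ** Z)) $ k $ l = L $ k $ s k * (diag d ** Z) $ s k $ l"
      by (rule matrix_mult_row_single) (simp add: L_def)
    also have "\<dots> = Z $ s k $ l"
      using d[of "s k"] by (simp add: L_def diag_mult_nth)
    also have "\<dots> = mat 1 $ k $ l"
      using pure_row[OF Z s, of k l] by (auto simp: mat_def)
    finally show ?thesis .
  qed
  then have "L ** (diag d ** Z) = mat 1" by (simp add: vec_eq_iff)
  moreover have "L $ k $ i \<ge> 0" for k i
    using d[of i] by (auto simp: L_def less_imp_le)
  ultimately show ?thesis by (rule that)
qed

lemma matrix_mult_nonneg:
  fixes A :: "real^'m^'n" and B :: "real^'k^'m"
  assumes "\<And>i j. A $ i $ j \<ge> 0" "\<And>i j. B $ i $ j \<ge> 0"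
  shows "(A ** B) $ i $ j \<ge> 0"
  using assms by (auto simp: matrix_matrix_mult_def intro!: sum_nonneg)

theorem theorem2p1:
  fixes \<alpha>1 \<alpha>2 :: real
    and \<theta>1 \<theta>2 :: "real^'n"
    and Z1 Z2 :: "real^'k^'n"
    and B1 B2 :: "real^'k^'k"
    and W :: "real^'n^'n"
  assumes "CARD('n) \<ge> CARD('k)"
    and "admissible \<alpha>1 \<theta>1 Z1 B1"
    and "admissible \<alpha>2 \<theta>2 Z2 B2"
    and "probability_matrix W"
    and "model_matrix \<alpha>1 (diag \<theta>1) Z1 B1 = W"
    and "W = model_matrix \<alpha>2 (diag \<theta>2) Z2 B2"
  shows "\<alpha>1 = \<alpha>2 \<and> diag \<theta>1 = diag \<theta>2 \<and>
    (\<exists>P :: real^'k^'k. permutation_matrix P \<and>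
       Z2 = Z1 ** P \<and> B2 = transpose P ** B1 ** P)"
proof -
  define Y1 where "Y1 = diag \<theta>1 ** Z1"
  define Y2 where "Y2 = diag \<theta>2 ** Z2"
  have \<alpha>: "\<alpha>1 > 0" "\<alpha>2 > 0" and I2: "cond_I2 Z1" "cond_I2 Z2"
    and \<theta>: "\<And>i. \<theta>1 $ i > 0" "\<And>i. \<theta>2 $ i > 0"
    and sum1: "(\<Sum>i\<in>UNIV. \<theta>1 $ i) = CARD('n)" and sum2: "(\<Sum>i\<in>UNIV. \<theta>2 $ i) = CARD('n)"
    and B: "strictly_pos_def B1" "strictly_pos_def B2"
    and diag1: "\<And>k. B1 $ k $ k = 1" and diag2: "\<And>k. B2 $ k $ k = 1"
    using assms(2,3) by (auto simp: admissible_def cond_I1_def cond_I3_def field_simps)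
  have W: "Y1 ** (\<alpha>1 *\<^sub>R B1) ** transpose Y1 = Y2 ** (\<alpha>2 *\<^sub>R B2) ** transpose Y2"
    using assms(5,6) by (simp add: model_matrix_factored Y1_def Y2_def)
  have inv: "invertible (\<alpha>1 *\<^sub>R B1)" "invertible (\<alpha>2 *\<^sub>R B2)"
    using \<alpha> B by (simp_all add: scalar_invertible strictly_pos_def_invertible)
  have Y_nonneg: "\<And>i k. Y1 $ i $ k \<ge> 0" "\<And>i k. Y2 $ i $ k \<ge> 0"
    using I2 \<theta> by (auto simp: Y1_def Y2_def diag_mult_nth cond_I2_def less_imp_le)
  obtain L1 where L1: "L1 ** Y1 = mat 1" "\<And>k i. L1 $ k $ i \<ge> 0"
    using nonneg_left_inverse[OF I2(1) \<theta>(1)] unfolding Y1_def by blast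
  obtain L2 where L2: "L2 ** Y2 = mat 1" "\<And>k i. L2 $ k $ i \<ge> 0"
    using nonneg_left_inverse[OF I2(2) \<theta>(2)] unfolding Y2_def by blast
  define N where "N = L2 ** Y1"
  define N' where "N' = L1 ** Y2"
  have Y1N: "Y1 = Y2 ** N"
    unfolding N_def by (rule factor_through_congruent[OF W L1(1) L2(1) inv(1)])
  have Y2N: "Y2 = Y1 ** N'"
    unfolding N'_def by (rule factor_through_congruent[OF W[symmetric] L2(1) L1(1) inv(2)])
  have NN': "N ** N' = mat 1"
    using L2(1) Y2N by (simp add: N_def flip: matrix_mul_assoc)
  have N_nonneg: "N $ i $ j \<ge> 0" and N'_nonneg: "N' $ i $ j \<ge> 0" for i j
    unfolding N_def N'_def by (intro matrix_mult_nonneg L1 L2 Y_nonneg)+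
  note N_row = nonneg_inverse_row[OF NN' N_nonneg N'_nonneg]
  note N_col = nonneg_inverse_col[OF NN' N_nonneg N'_nonneg]

  have L2': "transpose Y2 ** transpose L2 = mat 1"
    using L2(1) by (metis matrix_transpose_mul transpose_mat)
  \<comment> \<open>Substitute \<open>Y1 = Y2 ** N\<close> into \<open>W\<close>, then cancel
    \<open>Y2\<close> on the left by \<open>L2\<close> and its transpose on the right by
    \<open>transpose L2\<close>.\<close>
  have "L2 ** (Y2 ** (N ** (\<alpha>1 *\<^sub>R B1) ** transpose N) ** transpose Y2) ** transpose L2 =
      L2 ** (Y2 ** (\<alpha>2 *\<^sub>R B2) ** transpose Y2) ** transpose L2"
    using W by (simp add: Y1N matrix_transpose_mul matrix_mul_assoc)
  moreover have "L2 ** (Y2 ** X ** transpose Y2) ** transpose L2 = X" for X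
    by (metis L2' L2(1) matrix_mul_assoc matrix_mul_lid matrix_mul_rid)
  ultimately have "N ** (\<alpha>1 *\<^sub>R B1) ** transpose N = \<alpha>2 *\<^sub>R B2" by simp
  then have G: "\<alpha>1 *\<^sub>R (N ** B1 ** transpose N) = \<alpha>2 *\<^sub>R B2"
    by (simp add: matrix_scalar_ac flip: scalar_matrix_assoc)

  \<comment> \<open>This value is forced by \<open>G\<close>: as \<open>B1\<close> and
    \<open>B2\<close> have unit diagonal, the nonzero entry \<open>x\<close> of any row of
    \<open>N\<close> satisfies \<open>\<alpha>1 * x^2 = \<alpha>2\<close>.\<close>
  define c where "c = sqrt (\<alpha>2 / \<alpha>1)"
  have c: "c > 0" "c\<^sup>2 = \<alpha>2 / \<alpha>1"
    using \<alpha> by (auto simp: c_def)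
  have N_entry: "N $ k $ l = c" if "N $ k $ l \<noteq> 0" for k l
  proof -
    have zero: "N $ k $ m = 0" if "m \<noteq> l" for m
      using N_row[of k] \<open>N $ k $ l \<noteq> 0\<close> that by metis
    have "(N ** B1 ** transpose N) $ k $ k = (N ** B1) $ k $ l * N $ k $ l"
      by (subst matrix_mult_col_single[of l]) (simp_all add: transpose_def zero)
    also have "\<dots> = (N $ k $ l)\<^sup>2"
      by (simp add: matrix_mult_row_single[OF zero] diag1 power2_eq_square)
    finally have "(N ** B1 ** transpose N) $ k $ k = (N $ k $ l)\<^sup>2" .
    then have "\<alpha>1 * (N $ k $ l)\<^sup>2 = \<alpha>2"
      using arg_cong[OF G, of "\<lambda>M. M $ k $ k"] by (simp add: diag2)
    then have "(N $ k $ l)\<^sup>2 = c\<^sup>2"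
      using \<alpha> unfolding c(2) by (simp add: field_simps)
    then show ?thesis
      using N_nonneg c(1) by (simp add: power2_eq_iff_nonneg)
  qed
  define Q where "Q = (1 / c) *\<^sub>R N"
  have N_Q: "N = c *\<^sub>R Q"
    using c(1) by (simp add: Q_def)
  have Q_entry: "Q $ k $ l = (if N $ k $ l \<noteq> 0 then 1 else 0)" for k l
    using N_entry[of k l] c(1) by (simp add: Q_def)
  have perm: "permutation_matrix Q"
    using N_row N_col unfolding permutation_matrix_def Q_entry by simp
  note QQ = permutation_matrix_mult_transpose[OF perm]

  \<comment> \<open>Since \<open>Q\<close> is orthogonal, it drops out of the Gram matrix, and only
    the scale \<open>c\<close> separates the row norms of \<open>Y1\<close> and
    \<open>Y2\<close>.\<close>
  have "Y1 ** transpose Y1 = c\<^sup>2 *\<^sub>R (Y2 ** (Q ** transpose Q) ** transpose Y2)"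
    by (simp add: Y1N N_Q matrix_transpose_mul matrix_mul_assoc transpose_scalar
        matrix_scalar_ac power2_eq_square flip: scalar_matrix_assoc)
  then have gram: "Y1 ** transpose Y1 = c\<^sup>2 *\<^sub>R (Y2 ** transpose Y2)"
    by (simp add: QQ)
  have \<theta>_c: "\<theta>1 $ i = c * \<theta>2 $ i" for i
  proof -
    have "(\<theta>1 $ i)\<^sup>2 = (c * \<theta>2 $ i)\<^sup>2"
      using arg_cong[OF gram, of "\<lambda>M. M $ i $ i"] I2
      by (simp add: Y1_def Y2_def gram_diag_mult cond_I2_def power_mult_distrib)
    then show ?thesis
      using \<theta>[of i] c(1) by (simp add: power2_eq_iff_nonneg less_imp_le)
  qed
  \<comment> \<open>Sum \<open>\<theta>_c\<close> over all nodes; both degree sums equal the number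
    of nodes.\<close>
  have "real CARD('n) = c * real CARD('n)"
    using sum1 sum2 by (simp add: \<theta>_c flip: sum_distrib_left)
  then have c1: "c = 1" by simp
  have \<alpha>_eq: "\<alpha>1 = \<alpha>2"
    using c(2) c1 \<alpha> by simp
  have \<theta>_eq: "\<theta>1 = \<theta>2"
    by (simp add: vec_eq_iff \<theta>_c c1)

  \<comment> \<open>Now \<open>Y1 = Y2 ** Q\<close>, so the permutation taking the first
    factorization to the second is \<open>transpose Q\<close>.\<close>
  have "Y2 = Y2 ** (Q ** transpose Q)" by (simp add: QQ)
  also have "\<dots> = Y1 ** transpose Q"
    by (simp add: Y1N N_Q c1 matrix_mul_assoc)
  finally have "diag \<theta>1 ** Z2 = diag \<theta>1 ** (Z1 ** transpose Q)"
    by (simp add: Y1_def Y2_def \<theta>_eq matrix_mul_assoc)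
  then have "\<theta>1 $ i * Z2 $ i $ k = \<theta>1 $ i * (Z1 ** transpose Q) $ i $ k" for i k
    by (metis diag_mult_nth)
  then have "Z2 = Z1 ** transpose Q"
    using \<theta>(1) by (simp add: vec_eq_iff less_imp_neq[symmetric])
  moreover have "B2 = transpose (transpose Q) ** B1 ** transpose Q"
    using G \<alpha> \<alpha>_eq by (simp add: N_Q c1)
  ultimately show ?thesis
    using \<alpha>_eq \<theta>_eq permutation_matrix_transpose[OF perm] by blast
qed

end
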